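(* Let $(V,|\cdot|_V)$ be a real separable Banach space, $T>0$, $f:[0,T]\times V\to V$, and let $u\in C^1([0,T];V)$ be the solution of $u(0)=\vartheta\in V$, $u'(t)=f(t,u(t))$, $t\in[0,T]$, with exact flow map $\varphi$. Let $\psi$ be an approximate flow map, $(\xi_k)_{k\in\mathbb{N}_0}$ a sequence of $V$-valued stochastic processes on $[0,\infty)$, and $U_0$ a $V$-valued random variable. Let $\|\cdot\|_\Psi$ be an Orlicz norm. Suppose that: 1. there is $L_\varphi>0$ such that for all $t\in[0,T]$, all $h\ge 0$ with $t+h\le T$ and all $x,y\in V$, $|\varphi(h,t,x)-\varphi(h,t,y)|_V\le (1+L_\varphi h)|x-y|_V$; 2. there are $0<h^\ast<\infty$, $0<C_{\varphi,\psi}<\infty$ and $q\ge 0$ such that for all $0<h\le h^\ast$, $\sup_{v\in V,\ t\in[0,T-h]}|\varphi(h,t,v)-\psi(h,t,v)|_V\le C_{\varphi,\psi}h^{q+1}$; 3. there are $p\ge 0$ and $0<C_\xi<\infty$ such that $\|\xi_k(t)\|_\Psi\le C_\xi t^{p+1}$ for all $k\in\mathbb{N}_0$ and $t>0$; 4. $\|U_0\|_\Psi<\infty$. Then for any time grid $0=t_0<t_1<\dots<t_N=T$ whose maximal step $h=\max_k h_k$, $h_k=t_{k+1}-t_k$, satisfies $0<h\le h^\ast$, the error sequence $(e_k)_{k=0}^N$ satisfies $$\Big\|\max_{0\le k\le N}|e_k|_V\Big\|_\Psi\le\big(\|e_0\|_\Psi+C_{\varphi,\psi}h^qT+C_\xi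 h^pT\big)\exp(L_\varphi T).$$ In particular, if $\|e_0\|_\Psi=0$, then $\big\|\max_k|e_k|_V\big\|_\Psi=\mathcal{O}(h^{p\wedge q})$.
   Context: Flow map: it is assumed that the initial value problem has a unique classical solution (in $C^1$) for every initial condition; $\varphi(h,t,x)$ denotes the value at time $t+h$ of the solution of $u'=f(\cdot,u)$ that takes the value $x\in V$ at time $t$ ($t,h\ge0$, $t+h\le T$). Approximate flow map: $\psi(h,t,v)\in V$, defined for $0<h\le h^\ast$, $t\in[0,T-h]$, $v\in V$, is the output of one step of length $h$ of a deterministic one-step time integration method started at time $t$ from state $v$. Random approximating sequence and errors: all random variables live on a common probability space $(\Omega,\mathcal F,\mathbb P)$. Given a time grid, $U_{k+1}:=\psi(h_k,t_k,U_k)+\xi_k(h_k)$ for $k=0,\dots,N-1$ (these are understood to be $V$-valued random variables), and $e_k:=u(t_k)-U_k$ for $k=0,\dots,N$. Orlicz norm: for a Young function $\Psi:\mathbb{R}_{\ge0}\to\mathbb{R}_{\ge0}$ (in the N-function sense: $\Psi(z)=\int_0^z a(s)\,ds$ with $a$ nondecreasing, right-continuous, $a(0)=0$, $a(s)>0$ for $s>0$, $a(s)\to\infty$ as $s\to\infty$) and a real random variable $Z$, $\|Z\|_\Psi:=\inf\{k\in(0,\infty):\mathbb{E}[\Psi(|Z|/k)]\le1\}$. For a $V$-valued random variable $Z$, $\|Z\|_\Psi:=\||Z|_V\|_\Psi$. Examples: $\Psi(z)=z^R$, $R>1$, gives the $L^R$ norm; $\Psi(z)=\exp(z^2)-1$.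 Notation: $p\wedge q=\min\{p,q\}$; $a=\mathcal{O}(h^r)$ means $|a|\le Ch^r$ for some $C>0$ independent of $h$ (and of the grid).
   Formalization: The displayed bound fails for Young functions with Ψ(1)>1 (e.g. Ψ(z)=2z²), so it is stated for Ψ(1)≤1; for every Young function it is stated with C_{φ,ψ}h^qT replaced by the Orlicz norm of that constant. The O(h^{p∧q}) claim is unchanged. *)

theory Defs
  imports "HOL-Probability.Probability"
begin

(* Only the values of Psi on the nonnegative reals are constrained or used. *)
definition young_function :: "(real \<Rightarrow> real) \<Rightarrow> bool" where
  "young_function \<Psi> \<longleftrightarrow>
    (\<exists>a :: real \<Rightarrow> real.
        mono_on {0..} a
      \<and> (\<forall>s\<ge>0. continuous (at_right s) a)
      \<and> a 0 = 0
      \<and> (\<forall>s>0. a s > 0)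
      \<and> filterlim a at_top at_top
      \<and> (\<forall>z\<ge>0. (a has_integral \<Psi> z) {0..z}))"

(* Extended-real valued: the value is infinite if no k is admissible.  For real Z the norm is the
   absolute value, so this covers both real and vector valued random variables.
   Under a probability measure a constant c has norm |c| / r with Psi r = 1, which is at most |c|
   exactly when c = 0 or Psi 1 <= 1.  A bound that estimates deterministic contributions by their
   absolute value therefore needs Psi 1 <= 1; in general they have to be measured in the norm. *)
definition orlicz_norm :: "'w measure \<Rightarrow> (real \<Rightarrow> real) \<Rightarrow> ('w \<Rightarrow> 'a::real_normed_vector) \<Rightarrow> ennreal" where
  "orlicz_norm M \<Psi> Z =
    Inf {ennreal k | k. 0 < k \<and> (\<integral>\<^sup>+ \<omega>. ennreal (\<Psi> (norm (Z \<omega>) / k)) \<partial>M) \<le> 1}"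

(* Derivatives at the endpoints are one-sided.  Continuity of the derivative is expressed through
   the right-hand side, with which it coincides. *)
definition classical_solution ::
  "(real \<Rightarrow> 'a \<Rightarrow> 'a) \<Rightarrow> real \<Rightarrow> real \<Rightarrow> 'a \<Rightarrow> (real \<Rightarrow> 'a::real_normed_vector) \<Rightarrow> bool" where
  "classical_solution f t T x w \<longleftrightarrow>
      w t = x
    \<and> (\<forall>s\<in>{t..T}. (w has_vector_derivative f s (w s)) (at s within {t..T}))
    \<and> continuous_on {t..T} (\<lambda>s. f s (w s))"

definition uniquely_solvable :: "(real \<Rightarrow> 'a::real_normed_vector \<Rightarrow> 'a) \<Rightarrow> real \<Rightarrow> bool" where
  "uniquely_solvable f T \<longleftrightarrow>
    (\<forall>t\<in>{0..T}. \<forall>x. \<exists>w. classical_solution f t T x w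
       \<and> (\<forall>w'. classical_solution f t T x w' \<longrightarrow> (\<forall>s\<in>{t..T}. w' s = w s)))"

(* Meaningful for uniquely solvable f and 0 <= t, 0 <= h, t + h <= T. *)
definition flow_map ::
  "(real \<Rightarrow> 'a \<Rightarrow> 'a) \<Rightarrow> real \<Rightarrow> real \<Rightarrow> real \<Rightarrow> 'a \<Rightarrow> 'a::real_normed_vector" where
  "flow_map f T h t x = (THE y. \<exists>w. classical_solution f t T x w \<and> y = w (t + h))"

(* Only the grid points t 0, ..., t N matter. *)
definition time_grid :: "real \<Rightarrow> nat \<Rightarrow> (nat \<Rightarrow> real) \<Rightarrow> bool" where
  "time_grid T N t \<longleftrightarrow> t 0 = 0 \<and> t N = T \<and> (\<forall>k<N. t k < t (Suc k))"

definition step_size :: "(nat \<Rightarrow> real) \<Rightarrow> nat \<Rightarrow> real" where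
  "step_size t k = t (Suc k) - t k"

definition max_step :: "nat \<Rightarrow> (nat \<Rightarrow> real) \<Rightarrow> real" where
  "max_step N t = Max (step_size t ` {..<N})"

primrec approx_seq ::
  "(real \<Rightarrow> real \<Rightarrow> 'a \<Rightarrow> 'a) \<Rightarrow> (nat \<Rightarrow> real \<Rightarrow> 'w \<Rightarrow> 'a) \<Rightarrow> ('w \<Rightarrow> 'a) \<Rightarrow>
   (nat \<Rightarrow> real) \<Rightarrow> nat \<Rightarrow> 'w \<Rightarrow> 'a::real_normed_vector" where
  "approx_seq \<psi> \<xi> U0 t 0 = U0"
| "approx_seq \<psi> \<xi> U0 t (Suc k) =
    (\<lambda>\<omega>. \<psi> (step_size t k) (t k) (approx_seq \<psi> \<xi> U0 t k \<omega>) + \<xi> k (step_size t k) \<omega>)"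

definition err_seq ::
  "(real \<Rightarrow> 'a) \<Rightarrow> (real \<Rightarrow> real \<Rightarrow> 'a \<Rightarrow> 'a) \<Rightarrow> (nat \<Rightarrow> real \<Rightarrow> 'w \<Rightarrow> 'a) \<Rightarrow> ('w \<Rightarrow> 'a) \<Rightarrow>
   (nat \<Rightarrow> real) \<Rightarrow> nat \<Rightarrow> 'w \<Rightarrow> 'a::real_normed_vector" where
  "err_seq u \<psi> \<xi> U0 t k \<omega> = u (t k) - approx_seq \<psi> \<xi> U0 t k \<omega>"

(* A grid with maximal step in (0, hs], along which every U_k is a random variable: psi is not
   assumed measurable, so this does not follow from measurability of U_0 and of the noise. *)
definition admissible_grid ::
  "'w measure \<Rightarrow> real \<Rightarrow> real \<Rightarrow> (real \<Rightarrow> real \<Rightarrow> 'a \<Rightarrow> 'a) \<Rightarrow> (nat \<Rightarrow> real \<Rightarrow> 'w \<Rightarrow> 'a) \<Rightarrow>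
   ('w \<Rightarrow> 'a::real_normed_vector) \<Rightarrow> nat \<Rightarrow> (nat \<Rightarrow> real) \<Rightarrow> bool" where
  "admissible_grid M T hs \<psi> \<xi> U0 N t \<longleftrightarrow>
      time_grid T N t \<and> 0 < max_step N t \<and> max_step N t \<le> hs
    \<and> (\<forall>k\<le>N. approx_seq \<psi> \<xi> U0 t k \<in> borel_measurable M)"

end

(* Since u is a trajectory of the exact flow, the Lipschitz bound on the flow and the local error
   bound give |e_(k+1)| <= (1 + L h_k) |e_k| + C h_k^(q+1) + |xi_k(h_k)| pointwise.  A discrete
   Gronwall argument bounds the maximal error pointwise by exp (L T) times the sum of |e_0|, a
   constant and the noise terms; it remains to take Orlicz norms and to use the triangle
   inequality, which follows from the convexity of the Young function. *)

theory Submission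
  imports Defs
begin

section \<open>Young functions\<close>

text \<open>The density \<open>a\<close> is nondecreasing, so on the interval between
  \<open>w\<close> and \<open>y\<close> it stays on one side of the value \<open>a w\<close>.
  Integrating this comparison gives the supporting line with slope \<open>a w\<close>, from which
  monotonicity and convexity of \<open>\<Psi>\<close> are both derived.\<close>

lemma young_function_subgradient:
  assumes "young_function \<Psi>"
  obtains a where "\<And>s. s \<ge> 0 \<Longrightarrow> a s \<ge> (0::real)"
    and "\<And>w y. w \<ge> 0 \<Longrightarrow> y \<ge> 0 \<Longrightarrow> \<Psi> w + a w * (y - w) \<le> \<Psi> y"
proof -
  from assms obtain a :: "real \<Rightarrow> real" where mono: "mono_on {0..} a" and a0: "a 0 = 0"
    and pos: "\<And>s. s > 0 \<Longrightarrow> a s > 0"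
    and int: "\<And>z. z \<ge> 0 \<Longrightarrow> (a has_integral \<Psi> z) {0..z}"
    unfolding young_function_def by blast
  \<comment> \<open>The definition supplies integrals from 0 only; additivity over adjacent
    intervals turns increments of \<open>\<Psi>\<close> into integrals of \<open>a\<close>.\<close>
  have diff: "(a has_integral \<Psi> y - \<Psi> x) {x..y}" if "0 \<le> x" "x \<le> y" for x y
  proof -
    have "a integrable_on {0..y}" using int[of y] that by auto
    then have "a integrable_on {x..y}"
      by (rule integrable_on_subinterval) (use that in auto)
    then obtain I where I: "(a has_integral I) {x..y}" by blast
    then have "(a has_integral \<Psi> x + I) {0..y}"
      using that int[of x] by (intro has_integral_combine[of 0 x y]) auto
    then have "\<Psi> x + I = \<Psi> y" using int[of y] that by (auto intro: has_integral_unique)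
    then show ?thesis using I by (metis add_diff_cancel_left')
  qed
  show ?thesis
  proof
    show "a s \<ge> 0" if "s \<ge> 0" for s
      using pos[of s] a0 that by (cases "s = 0") auto
    show "\<Psi> w + a w * (y - w) \<le> \<Psi> y" if "w \<ge> 0" "y \<ge> 0" for w y
    proof (cases "w \<le> y")
      case True
      have "((\<lambda>_. a w) has_integral a w * (y - w)) {w..y}"
        using has_integral_const_real[of "a w" w y] True by (simp add: mult.commute)
      then have "a w * (y - w) \<le> \<Psi> y - \<Psi> w"
        by (rule has_integral_le[OF _ diff[OF that(1) True]])
          (use that in \<open>auto intro!: mono_onD[OF mono]\<close>)
      then show ?thesis by simp
    \<comment> \<open>To the left of \<open>w\<close> the density is at most \<open>a w\<close>; the
      reversed comparison and the negative sign of \<open>y - w\<close> give the same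
      inequality.\<close>
    next
      case False
      have "((\<lambda>_. a w) has_integral a w * (w - y)) {y..w}"
        using has_integral_const_real[of "a w" y w] False by (simp add: mult.commute)
      then have "\<Psi> w - \<Psi> y \<le> a w * (w - y)"
        using False that
        by (intro has_integral_le[OF diff[of y w]]) (auto intro!: mono_onD[OF mono])
      then show ?thesis by (simp add: algebra_simps)
    qed
  qed
qed

lemma young_function_zero: "young_function \<Psi> \<Longrightarrow> \<Psi> 0 = 0"
proof -
  assume "young_function \<Psi>"
  then obtain a :: "real \<Rightarrow> real" where "(a has_integral \<Psi> 0) {0..0}"
    unfolding young_function_def by blast
  then show "\<Psi> 0 = 0" using has_integral_refl(2)[of a 0] by (auto intro: has_integral_unique)
qed

lemma young_function_mono:
  assumes "young_function \<Psi>" "0 \<le> x" "x \<le> y"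
  shows "\<Psi> x \<le> \<Psi> y"
proof -
  obtain a where a: "\<And>s. s \<ge> 0 \<Longrightarrow> a s \<ge> (0::real)"
    "\<And>w y. w \<ge> 0 \<Longrightarrow> y \<ge> 0 \<Longrightarrow> \<Psi> w + a w * (y - w) \<le> \<Psi> y"
    using young_function_subgradient[OF assms(1)] by metis
  have "0 \<le> a x * (y - x)" using a(1)[of x] assms by simp
  then show ?thesis using a(2)[of x y] assms by simp
qed

lemma young_function_nonneg: "young_function \<Psi> \<Longrightarrow> 0 \<le> x \<Longrightarrow> 0 \<le> \<Psi> x"
  using young_function_mono[of \<Psi> 0 x] young_function_zero[of \<Psi>] by simp

lemma young_function_convex:
  assumes "young_function \<Psi>"
  shows "convex_on {0..} \<Psi>"
proof (rule convex_onI)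
  obtain a where a: "\<And>w y. w \<ge> 0 \<Longrightarrow> y \<ge> 0 \<Longrightarrow> \<Psi> w + a w * (y - w) \<le> \<Psi> y"
    using young_function_subgradient[OF assms] by metis
  fix s x y :: real
  assume s: "0 < s" "s < 1" and "x \<in> {0..}" "y \<in> {0..}"
  then have xy: "0 \<le> x" "0 \<le> y" by auto
  define w where "w = (1 - s) * x + s * y"
  have w: "w \<ge> 0" using xy s by (simp add: w_def)
  \<comment> \<open>Both supporting-line inequalities are taken at the intermediate point
    \<open>w\<close>. In their weighted average the slope terms cancel, since \<open>w\<close> is
    the same average of \<open>x\<close> and \<open>y\<close>.\<close>
  have "(1 - s) * (\<Psi> w + a w * (x - w)) + s * (\<Psi> w + a w * (y - w)) \<le> (1 - s) * \<Psi> x + s * \<Psi> y"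
    using a[OF w] xy s by (intro add_mono mult_left_mono) auto
  also have "(1 - s) * (\<Psi> w + a w * (x - w)) + s * (\<Psi> w + a w * (y - w))
      = \<Psi> w + a w * ((1 - s) * x + s * y - w)"
    by (simp add: algebra_simps)
  also have "\<dots> = \<Psi> w" by (simp add: w_def)
  finally show "\<Psi> ((1 - s) *\<^sub>R x + s *\<^sub>R y) \<le> (1 - s) * \<Psi> x + s * \<Psi> y"
    by (simp add: w_def)
qed simp

lemma young_function_measurable:
  assumes "young_function \<Psi>" and [measurable]: "X \<in> borel_measurable M"
    and "\<And>\<omega>. 0 \<le> X \<omega>"
  shows "(\<lambda>\<omega>. \<Psi> (X \<omega>)) \<in> borel_measurable M"
proof -
  \<comment> \<open>Nothing is known about \<open>\<Psi>\<close> on negative reals; truncating the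
    argument at 0 yields a function monotone on the whole line, hence Borel.\<close>
  have "mono (\<lambda>x. \<Psi> (max 0 x))"
    by (intro monoI young_function_mono[OF assms(1)]) auto
  then have [measurable]: "(\<lambda>x. \<Psi> (max 0 x)) \<in> borel_measurable borel"
    by (rule borel_measurable_mono)
  have "(\<lambda>\<omega>. \<Psi> (max 0 (X \<omega>))) \<in> borel_measurable M" by measurable
  moreover have "max 0 (X \<omega>) = X \<omega>" for \<omega> using assms(3)[of \<omega>] by simp
  ultimately show ?thesis by simp
qed

section \<open>Orlicz norms\<close>

lemma orlicz_norm_leI:
  assumes "0 < k" "(\<integral>\<^sup>+ \<omega>. ennreal (\<Psi> (norm (Z \<omega>) / k)) \<partial>M) \<le> 1"
  shows "orlicz_norm M \<Psi> Z \<le> ennreal k"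
  unfolding orlicz_norm_def using assms by (intro Inf_lower) blast

text \<open>Used wherever a norm stands on the right of an inequality: the argument runs through
  arbitrary admissible scales \<open>k\<close>, so the infimum need not be attained.\<close>

lemma le_orlicz_normI:
  assumes "\<And>k. 0 < k \<Longrightarrow> (\<integral>\<^sup>+ \<omega>. ennreal (\<Psi> (norm (Z \<omega>) / k)) \<partial>M) \<le> 1 \<Longrightarrow> b \<le> ennreal k"
  shows "b \<le> orlicz_norm M \<Psi> Z"
  unfolding orlicz_norm_def using assms by (intro Inf_greatest) blast

lemma orlicz_norm_mono:
  assumes "young_function \<Psi>" and "\<And>\<omega>. norm (X \<omega>) \<le> norm (Y \<omega>)"
  shows "orlicz_norm M \<Psi> X \<le> orlicz_norm M \<Psi> Y"
proof (rule le_orlicz_normI)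
  fix k :: real
  assume k: "0 < k" "(\<integral>\<^sup>+ \<omega>. ennreal (\<Psi> (norm (Y \<omega>) / k)) \<partial>M) \<le> 1"
  have "(\<integral>\<^sup>+ \<omega>. ennreal (\<Psi> (norm (X \<omega>) / k)) \<partial>M) \<le> (\<integral>\<^sup>+ \<omega>. ennreal (\<Psi> (norm (Y \<omega>) / k)) \<partial>M)"
    using k assms(2)
    by (intro nn_integral_mono ennreal_leI young_function_mono[OF assms(1)] divide_right_mono) auto
  also note k(2)
  finally show "orlicz_norm M \<Psi> X \<le> ennreal k" by (rule orlicz_norm_leI[OF k(1)])
qed

lemma orlicz_norm_zero:
  assumes "young_function \<Psi>"
  shows "orlicz_norm M \<Psi> (\<lambda>_. 0) = 0"
proof -
  have *: "orlicz_norm M \<Psi> (\<lambda>_. 0) \<le> ennreal k" if "0 < k" for k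
    using that by (intro orlicz_norm_leI) (simp_all add: young_function_zero[OF assms])
  have "orlicz_norm M \<Psi> (\<lambda>_. 0) \<le> 0"
    by (rule ennreal_le_epsilon) (simp add: *)
  then show ?thesis by simp
qed

lemma orlicz_norm_scaleR_le:
  assumes "0 < c"
  shows "orlicz_norm M \<Psi> (\<lambda>\<omega>. c *\<^sub>R X \<omega>) \<le> orlicz_norm M \<Psi> X * ennreal c"
proof -
  \<comment> \<open>If \<open>k\<close> is admissible for \<open>X\<close>, then
    \<open>k * c\<close> is admissible for the scaled variable. Dividing by \<open>c\<close>
    isolates the norm of \<open>X\<close> on the right, so that \<open>le_orlicz_normI\<close>
    applies; \<open>c\<close> is multiplied back at the end, being positive and finite.\<close>
  have "orlicz_norm M \<Psi> (\<lambda>\<omega>. c *\<^sub>R X \<omega>) / ennreal c \<le> orlicz_norm M \<Psi> X"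
  proof (rule le_orlicz_normI)
    fix k :: real
    assume k: "0 < k" "(\<integral>\<^sup>+ \<omega>. ennreal (\<Psi> (norm (X \<omega>) / k)) \<partial>M) \<le> 1"
    have "orlicz_norm M \<Psi> (\<lambda>\<omega>. c *\<^sub>R X \<omega>) \<le> ennreal (k * c)"
      using k assms by (intro orlicz_norm_leI) (auto simp: mult.commute[of k])
    then have "orlicz_norm M \<Psi> (\<lambda>\<omega>. c *\<^sub>R X \<omega>) / ennreal c \<le> ennreal (k * c) / ennreal c"
      by (rule divide_right_mono_ennreal)
    also have "\<dots> = ennreal k" using k assms by (simp add: divide_ennreal)
    finally show "orlicz_norm M \<Psi> (\<lambda>\<omega>. c *\<^sub>R X \<omega>) / ennreal c \<le> ennreal k" .
  qed
  then have "orlicz_norm M \<Psi> (\<lambda>\<omega>. c *\<^sub>R X \<omega>) / ennreal c * ennreal c \<le> orlicz_norm M \<Psi> X * ennreal c"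
    by (rule mult_right_mono) simp
  then show ?thesis using assms by 
    (simp add: divide_ennreal_def mult.assoc inverse_ennreal flip: ennreal_mult)
qed

text \<open>If \<open>k\<close> is admissible for \<open>X\<close> and \<open>l\<close> for
  \<open>Y\<close>, then \<open>k + l\<close> is admissible for the sum: (|X| + |Y|) / (k + l) is
  the convex combination of |X| / k and |Y| / l with weights k / (k + l) and l / (k + l). Convexity
  of \<open>\<Psi>\<close> bounds the integral by the same combination of two numbers that are at
  most 1.\<close>

lemma orlicz_norm_add_le:
  fixes X Y :: "'w \<Rightarrow> 'a::{banach, second_countable_topology}"
  assumes \<Psi>: "young_function \<Psi>"
    and [measurable]: "X \<in> borel_measurable M" "Y \<in> borel_measurable M"
  shows "orlicz_norm M \<Psi> (\<lambda>\<omega>. X \<omega> + Y \<omega>) \<le> orlicz_norm M \<Psi> X + orlicz_norm M \<Psi> Y"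
proof -
  have *: "orlicz_norm M \<Psi> (\<lambda>\<omega>. X \<omega> + Y \<omega>) \<le> ennreal k + ennreal l"
    if k: "0 < k" "(\<integral>\<^sup>+ \<omega>. ennreal (\<Psi> (norm (X \<omega>) / k)) \<partial>M) \<le> 1"
      and l: "0 < l" "(\<integral>\<^sup>+ \<omega>. ennreal (\<Psi> (norm (Y \<omega>) / l)) \<partial>M) \<le> 1" for k l
  proof -
    define s where "s = l / (k + l)"
    have s: "0 < s" "s < 1" "1 - s = k / (k + l)"
      using k l by (auto simp: s_def field_simps)
    have [measurable]: "(\<lambda>\<omega>. \<Psi> (norm (X \<omega>) / k)) \<in> borel_measurable M"
      "(\<lambda>\<omega>. \<Psi> (norm (Y \<omega>) / l)) \<in> borel_measurable M"
      using k l by (auto intro!: young_function_measurable[OF \<Psi>])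
    have "\<Psi> (norm (X \<omega> + Y \<omega>) / (k + l)) \<le> (1 - s) * \<Psi> (norm (X \<omega>) / k) + s * \<Psi> (norm (Y \<omega>) / l)" for \<omega>
    proof -
      have "norm (X \<omega> + Y \<omega>) / (k + l) \<le> (norm (X \<omega>) + norm (Y \<omega>)) / (k + l)"
        using k l by (intro divide_right_mono norm_triangle_ineq) auto
      also have "\<dots> = (1 - s) *\<^sub>R (norm (X \<omega>) / k) + s *\<^sub>R (norm (Y \<omega>) / l)"
        unfolding s(3) using k l by (simp add: s_def add_divide_distrib)
      finally have "\<Psi> (norm (X \<omega> + Y \<omega>) / (k + l)) \<le> \<Psi> \<dots>"
        using k l by (intro young_function_mono[OF \<Psi>]) auto
      also have "\<dots> \<le> (1 - s) * \<Psi> (norm (X \<omega>) / k) + s * \<Psi> (norm (Y \<omega>) / l)"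
        using s k l by (intro convex_onD[OF young_function_convex[OF \<Psi>]]) auto
      finally show ?thesis .
    qed
    then have "(\<integral>\<^sup>+ \<omega>. ennreal (\<Psi> (norm (X \<omega> + Y \<omega>) / (k + l))) \<partial>M)
        \<le> (\<integral>\<^sup>+ \<omega>. ennreal ((1 - s) * \<Psi> (norm (X \<omega>) / k) + s * \<Psi> (norm (Y \<omega>) / l)) \<partial>M)"
      by (intro nn_integral_mono ennreal_leI)
    also have "\<dots> = (\<integral>\<^sup>+ \<omega>. ennreal (1 - s) * ennreal (\<Psi> (norm (X \<omega>) / k))
        + ennreal s * ennreal (\<Psi> (norm (Y \<omega>) / l)) \<partial>M)"
      using s(1,2) k(1) l(1) young_function_nonneg[OF \<Psi>]
      by (intro nn_integral_cong) (simp add: ennreal_mult)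
    also have "\<dots> = ennreal (1 - s) * (\<integral>\<^sup>+ \<omega>. ennreal (\<Psi> (norm (X \<omega>) / k)) \<partial>M)
        + ennreal s * (\<integral>\<^sup>+ \<omega>. ennreal (\<Psi> (norm (Y \<omega>) / l)) \<partial>M)"
      by (simp add: nn_integral_add nn_integral_cmult)
    also have "\<dots> \<le> ennreal (1 - s) * 1 + ennreal s * 1"
      by (intro add_mono mult_left_mono k l) auto
    also have "\<dots> = 1" using s by (simp flip: ennreal_plus)
    finally have "orlicz_norm M \<Psi> (\<lambda>\<omega>. X \<omega> + Y \<omega>) \<le> ennreal (k + l)"
      using k l by (intro orlicz_norm_leI) auto
    then show ?thesis using k l by simp
  qed
  let ?N = "orlicz_norm M \<Psi> (\<lambda>\<omega>. X \<omega> + Y \<omega>)"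
  \<comment> \<open>The two infima are taken one after the other, each time moving the other summand
    to the left by subtraction in \<open>ennreal\<close>. The case of infinite norm of
    \<open>X\<close> is split off because truncated subtraction can be undone only away from
    \<open>top\<close>.\<close>
  show ?thesis
  proof (cases "orlicz_norm M \<Psi> X = top")
    case False
    have "?N - orlicz_norm M \<Psi> X \<le> orlicz_norm M \<Psi> Y"
    proof (rule le_orlicz_normI)
      fix l :: real
      assume l: "0 < l" "(\<integral>\<^sup>+ \<omega>. ennreal (\<Psi> (norm (Y \<omega>) / l)) \<partial>M) \<le> 1"
      have "?N - ennreal l \<le> orlicz_norm M \<Psi> X"
        by (rule le_orlicz_normI) (use *[OF _ _ l] in \<open>simp add: ennreal_minus_le_iff add.commute\<close>)
      then show "?N - orlicz_norm M \<Psi> X \<le> ennreal l"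
        using False by (simp add: ennreal_minus_le_iff add.commute)
    qed
    then show ?thesis using False by (simp add: ennreal_minus_le_iff)
  qed simp
qed

lemma orlicz_norm_sum_le:
  fixes X :: "'i \<Rightarrow> 'w \<Rightarrow> 'a::{banach, second_countable_topology}"
  assumes \<Psi>: "young_function \<Psi>"
    and "\<And>i. i \<in> A \<Longrightarrow> X i \<in> borel_measurable M"
  shows "orlicz_norm M \<Psi> (\<lambda>\<omega>. \<Sum>i\<in>A. X i \<omega>) \<le> (\<Sum>i\<in>A. orlicz_norm M \<Psi> (X i))"
  using assms(2)
proof (induction A rule: infinite_finite_induct)
  case (insert i A)
  have "orlicz_norm M \<Psi> (\<lambda>\<omega>. X i \<omega> + (\<Sum>i\<in>A. X i \<omega>))
      \<le> orlicz_norm M \<Psi> (X i) + orlicz_norm M \<Psi> (\<lambda>\<omega>. \<Sum>i\<in>A. X i \<omega>)"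
    using insert.prems by (intro orlicz_norm_add_le[OF \<Psi>] borel_measurable_sum) auto
  also have "\<dots> \<le> orlicz_norm M \<Psi> (X i) + (\<Sum>i\<in>A. orlicz_norm M \<Psi> (X i))"
    using insert by (intro add_left_mono) auto
  finally show ?case using insert.hyps by simp
qed (simp_all add: orlicz_norm_zero[OF \<Psi>])

text \<open>At scale \<open>norm c * r\<close> the integrand is the constant
  \<open>\<Psi> (1 / r)\<close>, and the total mass is 1. The case \<open>c = 0\<close> is separate
  because scales must be positive.\<close>

lemma orlicz_norm_const_le:
  fixes c :: "'a::real_normed_vector"
  assumes "prob_space M" "young_function \<Psi>" and r: "0 < r" "\<Psi> (1 / r) \<le> 1"
  shows "orlicz_norm M \<Psi> (\<lambda>_. c) \<le> ennreal (norm c * r)"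
proof (cases "c = 0")
  case True
  then show ?thesis by (simp add: orlicz_norm_zero[OF assms(2)])
next
  case False
  interpret prob_space M by fact
  show ?thesis
    using False r by (intro orlicz_norm_leI) (auto simp: emeasure_space_1)
qed

text \<open>Makes constants measurable in the norm even when \<open>\<Psi> 1\<close> exceeds 1: by
  convexity and \<open>\<Psi> 0 = 0\<close>, shrinking the argument by the factor 1 / r shrinks the
  value at least as much.\<close>

lemma young_function_exists_le_1:
  assumes "young_function \<Psi>"
  obtains r where "0 < r" "\<Psi> (1 / r) \<le> 1"
proof
  define r where "r = max 1 (\<Psi> 1)"
  have r: "r \<ge> 1" "r \<ge> \<Psi> 1" by (auto simp: r_def)
  then show "0 < r" by simp
  have "\<Psi> ((1 - 1 / r) *\<^sub>R 0 + (1 / r) *\<^sub>R 1) \<le> (1 - 1 / r) * \<Psi> 0 + (1 / r) * \<Psi> 1"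
    using r by (intro convex_onD[OF young_function_convex[OF assms]]) auto
  also have "\<dots> = \<Psi> 1 / r" using young_function_zero[OF assms] by simp
  also have "\<dots> \<le> 1" using r by simp
  finally show "\<Psi> (1 / r) \<le> 1" by simp
qed

section \<open>Error propagation\<close>

text \<open>Each factor \<open>1 + L * h k\<close> is at most \<open>exp (L * h k)\<close>, and the
  exponentials multiply to one of the summed steps. Every \<open>b k\<close> is charged the full
  exponential instead of the part accumulated after step \<open>k\<close>, which keeps the bound in
  product form.\<close>

lemma discrete_gronwall:
  fixes e b h :: "nat \<Rightarrow> real"
  assumes step: "\<And>k. k < n \<Longrightarrow> e (Suc k) \<le> (1 + L * h k) * e k + b k"
    and nonneg: "0 \<le> L" "0 \<le> e 0" "\<And>k. k < n \<Longrightarrow> 0 \<le> b k" "\<And>k. k < n \<Longrightarrow> 0 \<le> h k"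
  shows "e n \<le> exp (L * (\<Sum>k<n. h k)) * (e 0 + (\<Sum>k<n. b k))"
  using step nonneg(3,4)
proof (induction n)
  case (Suc n)
  let ?E = "exp (L * (\<Sum>k<n. h k))" and ?B = "e 0 + (\<Sum>k<n. b k)"
  have h: "0 \<le> L * h n" using Suc.prems nonneg(1) by simp
  have B: "0 \<le> ?B" using Suc.prems nonneg(2) by (intro add_nonneg_nonneg sum_nonneg) auto
  have E: "1 \<le> exp (L * (\<Sum>k<Suc n. h k))"
    using Suc.prems nonneg(1) by (auto intro!: mult_nonneg_nonneg sum_nonneg add_nonneg_nonneg)
  have "e (Suc n) \<le> (1 + L * h n) * e n + b n" by (rule Suc.prems) simp
  also have "\<dots> \<le> exp (L * h n) * (?E * ?B) + b n * exp (L * (\<Sum>k<Suc n. h k))"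
  proof (rule add_mono)
    have "(1 + L * h n) * e n \<le> (1 + L * h n) * (?E * ?B)"
      using h Suc.prems by (intro mult_left_mono Suc.IH) auto
    also have "\<dots> \<le> exp (L * h n) * (?E * ?B)"
      using B by (intro mult_right_mono exp_ge_add_one_self) auto
    finally show "(1 + L * h n) * e n \<le> exp (L * h n) * (?E * ?B)" .
    show "b n \<le> b n * exp (L * (\<Sum>k<Suc n. h k))"
      using mult_left_mono[OF E, of "b n"] Suc.prems by simp
  qed
  also have "\<dots> = exp (L * (\<Sum>k<Suc n. h k)) * (e 0 + (\<Sum>k<Suc n. b k))"
    by (simp add: exp_add algebra_simps)
  finally show ?case .
qed simp

text \<open>The restriction of \<open>u\<close> to [t, T] solves the initial value problem started
  at \<open>u t\<close>; uniqueness then makes the definite description in \<open>flow_map\<close>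
  pick the value of \<open>u\<close>.\<close>

lemma flow_map_solution:
  assumes "uniquely_solvable f T" "classical_solution f 0 T \<theta> u"
    and t: "0 \<le> t" "0 \<le> h" "t + h \<le> T"
  shows "flow_map f T h t (u t) = u (t + h)"
proof -
  have sub: "{t..T} \<subseteq> {0..T}" using t by auto
  have sol: "classical_solution f t T (u t) u"
    using assms(2) sub unfolding classical_solution_def
    by (auto intro: continuous_on_subset has_vector_derivative_within_subset[OF _ sub])
  have "t \<in> {0..T}" and mem: "t + h \<in> {t..T}" using t by auto
  then obtain w where
    w: "\<And>w'. classical_solution f t T (u t) w' \<Longrightarrow> \<forall>s\<in>{t..T}. w' s = w s"
    using assms(1) unfolding uniquely_solvable_def by blast
  have uniq: "w' (t + h) = u (t + h)" if "classical_solution f t T (u t) w'" for w'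
    using bspec[OF w[OF that] mem] bspec[OF w[OF sol] mem] by simp
  show ?thesis
    unfolding flow_map_def
  proof (rule the_equality)
    show "\<exists>w. classical_solution f t T (u t) w \<and> u (t + h) = w (t + h)"
      using sol by blast
    show "y = u (t + h)" if "\<exists>w. classical_solution f t T (u t) w \<and> y = w (t + h)" for y
      using that uniq by blast
  qed
qed

theorem theorem2p8:
  fixes M :: "'w measure"
    and T L C\<^sub>\<phi>\<^sub>\<psi> C\<^sub>\<xi> hs p q :: real
    and f :: "real \<Rightarrow> 'a \<Rightarrow> 'a::{banach, second_countable_topology}"
    and u :: "real \<Rightarrow> 'a"
    and \<theta> :: 'a
    and \<psi> :: "real \<Rightarrow> real \<Rightarrow> 'a \<Rightarrow> 'a"
    and \<xi> :: "nat \<Rightarrow> real \<Rightarrow> 'w \<Rightarrow> 'a"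
    and U0 :: "'w \<Rightarrow> 'a"
    and \<Psi> :: "real \<Rightarrow> real"
  assumes prob: "prob_space M"
    and T: "T > 0"
    and solvable: "uniquely_solvable f T"
    and u: "classical_solution f 0 T \<theta> u"
    and process: "\<And>k t. t \<ge> 0 \<Longrightarrow> \<xi> k t \<in> borel_measurable M"
    and U0: "U0 \<in> borel_measurable M"
    and young: "young_function \<Psi>"
    and L: "L > 0"
    and flow_lipschitz: "\<And>t h x y. t \<in> {0..T} \<Longrightarrow> h \<ge> 0 \<Longrightarrow> t + h \<le> T \<Longrightarrow>
          norm (flow_map f T h t x - flow_map f T h t y) \<le> (1 + L * h) * norm (x - y)"
    and hs: "hs > 0" and C_pos: "C\<^sub>\<phi>\<^sub>\<psi> > 0" and q: "q \<ge> 0"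
    and local_error: "\<And>h. 0 < h \<Longrightarrow> h \<le> hs \<Longrightarrow>
          (SUP v. SUP t\<in>{0..T - h}. ennreal (norm (flow_map f T h t v - \<psi> h t v)))
            \<le> ennreal (C\<^sub>\<phi>\<^sub>\<psi> * h powr (q + 1))"
    and p: "p \<ge> 0" and C\<xi>_pos: "C\<^sub>\<xi> > 0"
    and noise: "\<And>k t. t > 0 \<Longrightarrow> orlicz_norm M \<Psi> (\<xi> k t) \<le> ennreal (C\<^sub>\<xi> * t powr (p + 1))"
    and U0_finite: "orlicz_norm M \<Psi> U0 < \<infinity>"
  shows
    "(\<forall>N t. admissible_grid M T hs \<psi> \<xi> U0 N t \<longrightarrow>
        (\<Psi> 1 \<le> 1 \<longrightarrow>
          orlicz_norm M \<Psi> (\<lambda>\<omega>. MAX k\<in>{0..N}. norm (err_seq u \<psi> \<xi> U0 t k \<omega>))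
            \<le> (orlicz_norm M \<Psi> (err_seq u \<psi> \<xi> U0 t 0)
                + ennreal (C\<^sub>\<phi>\<^sub>\<psi> * max_step N t powr q * T)
                + ennreal (C\<^sub>\<xi> * max_step N t powr p * T)) * ennreal (exp (L * T)))
      \<and> orlicz_norm M \<Psi> (\<lambda>\<omega>. MAX k\<in>{0..N}. norm (err_seq u \<psi> \<xi> U0 t k \<omega>))
            \<le> (orlicz_norm M \<Psi> (err_seq u \<psi> \<xi> U0 t 0)
                + orlicz_norm M \<Psi> (\<lambda>_. C\<^sub>\<phi>\<^sub>\<psi> * max_step N t powr q * T)
                + ennreal (C\<^sub>\<xi> * max_step N t powr p * T)) * ennreal (exp (L * T)))
   \<and> (orlicz_norm M \<Psi> (\<lambda>\<omega>. u 0 - U0 \<omega>) = 0 \<longrightarrow>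
        (\<exists>C>0. \<forall>N t. admissible_grid M T hs \<psi> \<xi> U0 N t \<longrightarrow>
          orlicz_norm M \<Psi> (\<lambda>\<omega>. MAX k\<in>{0..N}. norm (err_seq u \<psi> \<xi> U0 t k \<omega>))
            \<le> ennreal (C * max_step N t powr (min p q))))"
proof -

  \<comment> \<open>Arithmetic of time grids\<close>
  have step_pos: "0 < step_size t k" if "time_grid T N t" "k < N" for N t k
    using that by (auto simp: time_grid_def step_size_def)
  have step_le: "step_size t k \<le> max_step N t" if "k < N" for N t k
    using that by (auto simp: max_step_def)
  have sum_step: "(\<Sum>k<n. step_size t k) = t n" if "time_grid T N t" for N t n
    using that sum_lessThan_telescope[of t n] by (simp add: time_grid_def step_size_def)
  have grid_mono: "t j \<le> t k" if "time_grid T N t" "j \<le> k" "k \<le> N" for N t j k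
    using that(2,3)
  proof (induction k rule: dec_induct)
    case (step k)
    moreover have "t k < t (Suc k)" using that(1) step.prems by (simp add: time_grid_def)
    ultimately show ?case by simp
  qed simp
  \<comment> \<open>Local order r + 1 becomes global order r: all but one factor of each step is
    bounded by the maximal step, and the remaining factors sum to \<open>T\<close>.\<close>
  have powr_step: "(\<Sum>k<N. c * step_size t k powr (r + 1)) \<le> c * max_step N t powr r * T"
    if "time_grid T N t" "0 \<le> r" "0 \<le> c" for N t and c r :: real
  proof -
    have "c * step_size t k powr (r + 1) \<le> c * max_step N t powr r * step_size t k" if "k < N" for k
      using step_pos[OF \<open>time_grid T N t\<close> that] step_le[OF that, of t] \<open>0 \<le> r\<close> \<open>0 \<le> c\<close>
      by (auto simp: powr_add mult.assoc intro!: mult_left_mono mult_right_mono powr_mono2)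
    then have "(\<Sum>k<N. c * step_size t k powr (r + 1)) \<le> (\<Sum>k<N. c * max_step N t powr r * step_size t k)"
      by (intro sum_mono) simp
    also have "\<dots> = c * max_step N t powr r * T"
      using sum_step[OF that(1), of N] that(1) by (simp add: time_grid_def flip: sum_distrib_left)
    finally show ?thesis .
  qed
  \<comment> \<open>Here the deterministic error is still measured in the Orlicz norm. All
    conclusions come from this estimate, by different bounds on the norm of that constant.\<close>
  have bound: "orlicz_norm M \<Psi> (\<lambda>\<omega>. MAX k\<in>{0..N}. norm (err_seq u \<psi> \<xi> U0 t k \<omega>))
      \<le> (orlicz_norm M \<Psi> (err_seq u \<psi> \<xi> U0 t 0)
          + orlicz_norm M \<Psi> (\<lambda>_. C\<^sub>\<phi>\<^sub>\<psi> * max_step N t powr q * T)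
          + ennreal (C\<^sub>\<xi> * max_step N t powr p * T)) * ennreal (exp (L * T))"
    if "admissible_grid M T hs \<psi> \<xi> U0 N t" for N t
  proof -
    from that have grid: "time_grid T N t" and h_le: "max_step N t \<le> hs"
      by (auto simp: admissible_grid_def)
    let ?e = "err_seq u \<psi> \<xi> U0 t" and ?h = "step_size t"
    define c where "c = C\<^sub>\<phi>\<^sub>\<psi> * max_step N t powr q * T"
    \<comment> \<open>A random majorant that does not depend on the index of the error, so that it
      controls the maximum over the grid at once.\<close>
    define R where "R \<omega> = norm (?e 0 \<omega>) + c + (\<Sum>k<N. norm (\<xi> k (?h k) \<omega>))" for \<omega>
    have c: "0 \<le> c" using C_pos T by (simp add: c_def)
    have R: "0 \<le> R \<omega>" for \<omega> using c by (simp add: R_def sum_nonneg)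
    have recursion: "norm (?e (Suc k) \<omega>)
        \<le> (1 + L * ?h k) * norm (?e k \<omega>) + (C\<^sub>\<phi>\<^sub>\<psi> * ?h k powr (q + 1) + norm (\<xi> k (?h k) \<omega>))"
      if k: "k < N" for k \<omega>
    proof -
      let ?U = "approx_seq \<psi> \<xi> U0 t k \<omega>"
      have h: "0 < ?h k" "?h k \<le> hs" using step_pos[OF grid k] step_le[OF k, of t] h_le by auto
      have t: "0 \<le> t k" "t k + ?h k = t (Suc k)" "t (Suc k) \<le> T"
        using grid_mono[OF grid, of 0 k] grid_mono[OF grid, of "Suc k" N] grid k
        by (auto simp: time_grid_def step_size_def)
      \<comment> \<open>The next grid point is at most \<open>T\<close>, so \<open>t k\<close>
        belongs to the range of the supremum in \<open>local_error\<close>.\<close>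
      have "t k \<in> {0..T - ?h k}" using t by auto
      then have "ennreal (norm (flow_map f T (?h k) (t k) ?U - \<psi> (?h k) (t k) ?U))
          \<le> (SUP s\<in>{0..T - ?h k}. ennreal (norm (flow_map f T (?h k) s ?U - \<psi> (?h k) s ?U)))"
        by (rule SUP_upper)
      also have "\<dots> \<le> (SUP v. SUP s\<in>{0..T - ?h k}. ennreal (norm (flow_map f T (?h k) s v - \<psi> (?h k) s v)))"
        by (rule SUP_upper) simp
      also note local_error[OF h]
      finally have loc: "norm (flow_map f T (?h k) (t k) ?U - \<psi> (?h k) (t k) ?U) \<le> C\<^sub>\<phi>\<^sub>\<psi> * ?h k powr (q + 1)"
        using C_pos by simp
      have lip: "norm (u (t (Suc k)) - flow_map f T (?h k) (t k) ?U) \<le> (1 + L * ?h k) * norm (?e k \<omega>)"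
        using flow_lipschitz[of "t k" "?h k" "u (t k)" ?U]
          flow_map_solution[OF solvable u, of "t k" "?h k"] t h
        by (simp add: err_seq_def)
      \<comment> \<open>The exact flow started from the numerical state is inserted. The three terms
        are the propagated error, the local truncation error and the noise.\<close>
      have eq: "?e (Suc k) \<omega> = (u (t (Suc k)) - flow_map f T (?h k) (t k) ?U)
          + (flow_map f T (?h k) (t k) ?U - \<psi> (?h k) (t k) ?U) + - \<xi> k (?h k) \<omega>"
        by (simp add: err_seq_def)
      have "norm (?e (Suc k) \<omega>) \<le> norm (u (t (Suc k)) - flow_map f T (?h k) (t k) ?U)
          + norm (flow_map f T (?h k) (t k) ?U - \<psi> (?h k) (t k) ?U) + norm (- \<xi> k (?h k) \<omega>)"
        unfolding eq by (rule order_trans[OF norm_triangle_ineq add_right_mono[OF norm_triangle_ineq]])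
      then show ?thesis using loc lip by simp
    qed
    have pointwise: "norm (?e n \<omega>) \<le> exp (L * T) * R \<omega>" if n: "n \<le> N" for n \<omega>
    proof -
      have h0: "0 \<le> ?h k" if "k < N" for k using step_pos[OF grid that] by simp
      let ?b = "\<lambda>k. C\<^sub>\<phi>\<^sub>\<psi> * ?h k powr (q + 1) + norm (\<xi> k (?h k) \<omega>)"
      have b0: "0 \<le> ?b k" for k using C_pos by simp
      have "norm (?e n \<omega>) \<le> exp (L * (\<Sum>k<n. ?h k)) * (norm (?e 0 \<omega>) + (\<Sum>k<n. ?b k))"
        using n h0 b0 recursion L
        by (intro discrete_gronwall[where e = "\<lambda>k. norm (?e k \<omega>)" and h = ?h and b = ?b]) auto
      also have "\<dots> \<le> exp (L * T) * R \<omega>"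
      proof (rule mult_mono)
        show "exp (L * (\<Sum>k<n. ?h k)) \<le> exp (L * T)"
          using grid_mono[OF grid n] L grid by (simp add: sum_step[OF grid] time_grid_def)
        \<comment> \<open>Nonnegativity of the terms allows summation over the whole grid, which
          removes the dependence on \<open>n\<close>.\<close>
        have "(\<Sum>k<n. ?b k) \<le> (\<Sum>k<N. ?b k)"
          using n b0 by (intro sum_mono2) auto
        also have "\<dots> \<le> c + (\<Sum>k<N. norm (\<xi> k (?h k) \<omega>))"
          using powr_step[OF grid q, of "C\<^sub>\<phi>\<^sub>\<psi>"] C_pos by (simp add: sum.distrib c_def)
        finally show "norm (?e 0 \<omega>) + (\<Sum>k<n. ?b k) \<le> R \<omega>" by (simp add: R_def)
      qed (use C_pos in \<open>auto intro!: add_nonneg_nonneg sum_nonneg\<close>)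
      finally show ?thesis .
    qed

    \<comment> \<open>From the pointwise majorant to Orlicz norms\<close>
    have meas_e: "(\<lambda>\<omega>. norm (?e 0 \<omega>)) \<in> borel_measurable M"
      using U0 by (simp add: err_seq_def)
    have meas_xi: "(\<lambda>\<omega>. norm (\<xi> k (?h k) \<omega>)) \<in> borel_measurable M" if "k < N" for k
      using process[of "?h k" k] step_pos[OF grid that] by simp
    have norm_norm: "orlicz_norm M \<Psi> (\<lambda>\<omega>. norm (X \<omega>)) = orlicz_norm M \<Psi> X" for X :: "'w \<Rightarrow> 'a"
      by (simp add: orlicz_norm_def)
    have "orlicz_norm M \<Psi> (\<lambda>\<omega>. \<Sum>k<N. norm (\<xi> k (?h k) \<omega>))
        \<le> (\<Sum>k<N. orlicz_norm M \<Psi> (\<lambda>\<omega>. norm (\<xi> k (?h k) \<omega>)))"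
      using meas_xi by (intro orlicz_norm_sum_le[OF young]) auto
    also have "\<dots> \<le> (\<Sum>k<N. ennreal (C\<^sub>\<xi> * ?h k powr (p + 1)))"
      using noise step_pos[OF grid] by (intro sum_mono) (simp add: norm_norm)
    also have "\<dots> = ennreal (\<Sum>k<N. C\<^sub>\<xi> * ?h k powr (p + 1))"
      using C\<xi>_pos by (intro sum_ennreal) auto
    also have "\<dots> \<le> ennreal (C\<^sub>\<xi> * max_step N t powr p * T)"
      using C\<xi>_pos by (intro ennreal_leI powr_step[OF grid p]) auto
    finally have xi_le: "orlicz_norm M \<Psi> (\<lambda>\<omega>. \<Sum>k<N. norm (\<xi> k (?h k) \<omega>))
        \<le> ennreal (C\<^sub>\<xi> * max_step N t powr p * T)" .
    have "orlicz_norm M \<Psi> R \<le> orlicz_norm M \<Psi> (\<lambda>\<omega>. norm (?e 0 \<omega>) + c)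
        + orlicz_norm M \<Psi> (\<lambda>\<omega>. \<Sum>k<N. norm (\<xi> k (?h k) \<omega>))"
      unfolding R_def using meas_e meas_xi
      by (intro orlicz_norm_add_le[OF young] borel_measurable_sum borel_measurable_add) auto
    also have "\<dots> \<le> (orlicz_norm M \<Psi> (\<lambda>\<omega>. norm (?e 0 \<omega>)) + orlicz_norm M \<Psi> (\<lambda>_. c))
        + ennreal (C\<^sub>\<xi> * max_step N t powr p * T)"
      using meas_e by (intro add_mono orlicz_norm_add_le[OF young] xi_le) auto
    finally have R_le: "orlicz_norm M \<Psi> R \<le> orlicz_norm M \<Psi> (?e 0) + orlicz_norm M \<Psi> (\<lambda>_. c)
        + ennreal (C\<^sub>\<xi> * max_step N t powr p * T)"
      by (simp add: norm_norm)
    have "orlicz_norm M \<Psi> (\<lambda>\<omega>. MAX k\<in>{0..N}. norm (?e k \<omega>)) \<le> orlicz_norm M \<Psi> (\<lambda>\<omega>. exp (L * T) *\<^sub>R R \<omega>)"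
    proof (rule orlicz_norm_mono[OF young])
      fix \<omega>
      \<comment> \<open>The maximum dominates the initial error and is thus nonnegative, so the
        absolute value hidden in its norm disappears.\<close>
      have "0 \<le> norm (?e 0 \<omega>)" by simp
      also have "\<dots> \<le> (MAX k\<in>{0..N}. norm (?e k \<omega>))" by (intro Max_ge) auto
      finally have "norm (MAX k\<in>{0..N}. norm (?e k \<omega>)) = (MAX k\<in>{0..N}. norm (?e k \<omega>))" by simp
      also have "\<dots> \<le> exp (L * T) * R \<omega>" using pointwise by (intro Max.boundedI) auto
      finally show "norm (MAX k\<in>{0..N}. norm (?e k \<omega>)) \<le> norm (exp (L * T) *\<^sub>R R \<omega>)"
        using R[of \<omega>] by (simp add: abs_mult)
    qed
    also have "\<dots> \<le> orlicz_norm M \<Psi> R * ennreal (exp (L * T))"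
      by (rule orlicz_norm_scaleR_le) simp
    also have "\<dots> \<le> (orlicz_norm M \<Psi> (?e 0) + orlicz_norm M \<Psi> (\<lambda>_. c)
        + ennreal (C\<^sub>\<xi> * max_step N t powr p * T)) * ennreal (exp (L * T))"
      by (intro mult_right_mono R_le) simp
    finally show ?thesis by (simp add: c_def)
  qed
  have const: "orlicz_norm M \<Psi> (\<lambda>_. C\<^sub>\<phi>\<^sub>\<psi> * H powr q * T) \<le> ennreal (C\<^sub>\<phi>\<^sub>\<psi> * H powr q * T * r)"
    if "0 < r" "\<Psi> (1 / r) \<le> 1" for r H
    using orlicz_norm_const_le[OF prob young that, of "C\<^sub>\<phi>\<^sub>\<psi> * H powr q * T"] C_pos T by simp
  have part1: "orlicz_norm M \<Psi> (\<lambda>\<omega>. MAX k\<in>{0..N}. norm (err_seq u \<psi> \<xi> U0 t k \<omega>))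
      \<le> (orlicz_norm M \<Psi> (err_seq u \<psi> \<xi> U0 t 0)
          + ennreal (C\<^sub>\<phi>\<^sub>\<psi> * max_step N t powr q * T)
          + ennreal (C\<^sub>\<xi> * max_step N t powr p * T)) * ennreal (exp (L * T))"
    if "admissible_grid M T hs \<psi> \<xi> U0 N t" "\<Psi> 1 \<le> 1" for N t
    \<comment> \<open>With \<open>\<Psi> 1 \<le> 1\<close> the choice r = 1 is allowed, and the norm
      of the constant is at most the constant itself.\<close>
    using const[of 1] that(2)
    by (intro order_trans[OF bound[OF that(1)]] mult_right_mono add_mono) auto
  have part2: "\<exists>C>0. \<forall>N t. admissible_grid M T hs \<psi> \<xi> U0 N t \<longrightarrow>
      orlicz_norm M \<Psi> (\<lambda>\<omega>. MAX k\<in>{0..N}. norm (err_seq u \<psi> \<xi> U0 t k \<omega>))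
        \<le> ennreal (C * max_step N t powr (min p q))"
    if e0: "orlicz_norm M \<Psi> (\<lambda>\<omega>. u 0 - U0 \<omega>) = 0"
  proof -
    obtain r where r: "0 < r" "\<Psi> (1 / r) \<le> 1" by (rule young_function_exists_le_1[OF young])
    let ?m = "min p q"
    \<comment> \<open>Powers of the maximal step beyond the smaller exponent are absorbed into
      powers of \<open>hs\<close>, and \<open>r\<close> converts the deterministic constant into its
      norm bound. The result depends on neither \<open>N\<close> nor \<open>t\<close>, as the
      quantifier order requires.\<close>
    define C where "C = (C\<^sub>\<phi>\<^sub>\<psi> * hs powr (q - ?m) * T * r + C\<^sub>\<xi> * hs powr (p - ?m) * T) * exp (L * T)"
    have split: "H powr s \<le> hs powr (s - ?m) * H powr ?m" if "0 < H" "H \<le> hs" "?m \<le> s" for H s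
    proof -
      have "H powr s = H powr (s - ?m) * H powr ?m" by (simp flip: powr_add)
      also have "\<dots> \<le> hs powr (s - ?m) * H powr ?m"
        using that by (intro mult_right_mono powr_mono2) auto
      finally show ?thesis .
    qed
    have "0 < C" using C_pos C\<xi>_pos T r hs by (simp add: C_def add_pos_pos)
    moreover have "orlicz_norm M \<Psi> (\<lambda>\<omega>. MAX k\<in>{0..N}. norm (err_seq u \<psi> \<xi> U0 t k \<omega>))
        \<le> ennreal (C * max_step N t powr ?m)"
      if adm: "admissible_grid M T hs \<psi> \<xi> U0 N t" for N t
    proof -
      define H where "H = max_step N t"
      have H: "0 < H" "H \<le> hs" and t0: "t 0 = 0"
        using adm by (auto simp: admissible_grid_def H_def time_grid_def)
      \<comment> \<open>Every grid starts at 0, so the initial error is the same for all grids and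
        its vanishing norm can be assumed before a grid is chosen.\<close>
      have "err_seq u \<psi> \<xi> U0 t 0 = (\<lambda>\<omega>. u 0 - U0 \<omega>)"
        using t0 by (simp add: err_seq_def fun_eq_iff)
      then have "orlicz_norm M \<Psi> (\<lambda>\<omega>. MAX k\<in>{0..N}. norm (err_seq u \<psi> \<xi> U0 t k \<omega>))
          \<le> (orlicz_norm M \<Psi> (\<lambda>_. C\<^sub>\<phi>\<^sub>\<psi> * H powr q * T)
              + ennreal (C\<^sub>\<xi> * H powr p * T)) * ennreal (exp (L * T))"
        using bound[OF adm] e0 by (simp add: H_def)
      also have "\<dots> \<le> (ennreal (C\<^sub>\<phi>\<^sub>\<psi> * H powr q * T * r) + ennreal (C\<^sub>\<xi> * H powr p * T)) * ennreal (exp (L * T))"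
        using const[OF r] by (intro mult_right_mono add_mono) auto
      also have "\<dots> = ennreal ((C\<^sub>\<phi>\<^sub>\<psi> * H powr q * T * r + C\<^sub>\<xi> * H powr p * T) * exp (L * T))"
        using C_pos C\<xi>_pos T r by (simp add: ennreal_mult)
      also have "\<dots> \<le> ennreal ((C\<^sub>\<phi>\<^sub>\<psi> * (hs powr (q - ?m) * H powr ?m) * T * r
          + C\<^sub>\<xi> * (hs powr (p - ?m) * H powr ?m) * T) * exp (L * T))"
        using C_pos C\<xi>_pos T r
        by (intro ennreal_leI mult_right_mono mult_left_mono add_mono split H) auto
      also have "\<dots> = ennreal (C * H powr ?m)"
        by (simp add: C_def algebra_simps)
      finally show ?thesis by (simp add: H_def)
    qed
    ultimately show ?thesis by blast
  qed
  show ?thesis using part1 part2 bound by blast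
qed

end
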